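(* Let $k\ge 1$, let $r_1,\dots,r_k\in\mathbb{C}\setminus\{0\}$ be pairwise distinct, let $a_1,\dots,a_k\in\mathbb{C}\setminus\{0\}$, and let $\mathbf{s}[l]=\sum_{n=1}^{k}a_n r_n^{l}$ for $l\in\mathbb{N}_0$. Then, regardless of $j\in\mathbb{N}_0$ and of $\phi_k=\{\phi_k[0]<\dots<\phi_k[k-1]\}\subset\mathbb{N}_0$, the volume quotients $\mathbf{v}_j(\phi_{k,\mathbf{s}})$ of the combinatorial $k$-simplexes satisfy $$\mathbf{v}_j(\phi_{k,\mathbf{s}})=\Big\{1,\ \dots,\ \sum_{1\le i_1<i_2<\dots<i_l\le k}\ \prod_{n=1}^{l}r_{i_n},\ \dots,\ \prod_{n=1}^{k}r_n\Big\},$$ i.e. for each $l=0,1,\dots,k$ the $l$-th entry of $\mathbf{v}_j(\phi_{k,\mathbf{s}})$ equals the $l$-th elementary symmetric polynomial of $r_1,\dots,r_k$.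
   Context: $\mathbb{N}_0=\{0\}\cup\mathbb{N}$. For $m\in\mathbb{N}_0$ let $$\Xi_1(\phi_{k,\mathbf{s}})[m]=\big(\mathbf{s}[\phi_k[0]+m],\ \dots,\ \mathbf{s}[\phi_k[k-1]+m]\big)^{\mathrm T}\in\mathbb{C}^k.$$ For $v_0,\dots,v_{k-1}\in\mathbb{C}^k$, $e(v_0,\dots,v_{k-1})$ is the $k$-simplex with vertices the origin and $v_0,\dots,v_{k-1}$, with (signed, complex-valued) volume $\Lambda(e(v_0,\dots,v_{k-1}))=\det([v_0,\dots,v_{k-1}])/k!$. The $j$-th union polyhedron has as vertices the origin and the $k+1$ points $\Xi_1(\phi_{k,\mathbf{s}})[j],\dots,\Xi_1(\phi_{k,\mathbf{s}})[j+k]$ (it is obtained by pasting the two consecutive simplexes $e(\Xi_1(\phi_{k,\mathbf{s}})[j],\dots,\Xi_1(\phi_{k,\mathbf{s}})[j+k-1])$ and $e(\Xi_1(\phi_{k,\mathbf{s}})[j+1],\dots,\Xi_1(\phi_{k,\mathbf{s}})[j+k])$). The $j$-th series of combinatorial $k$-simplexes $\varkappa_j(\phi_{k,\mathbf{s}})$ consists of the $k+1$ simplexes formed by the origin and $k$ of these $k+1$ points, kept in increasing order of index, listed in lexicographic order of the chosen index sets. Thus, for $l=0,\dots,k$, $\varkappa_j(\phi_{k,\mathbf{s}})[l]$ is the simplex $e(\cdot)$ on the points $\Xi_1(\phi_{k,\mathbf{s}})[j+m]$, $m\in\{0,\dots,k\}\setminus\{k-l\}$, in increasing order of $m$. The volume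 quotients are $$\mathbf{v}_j(\phi_{k,\mathbf{s}})=\Big\{\frac{\Lambda(\varkappa_j(\phi_{k,\mathbf{s}})[0])}{\Lambda(\varkappa_j(\phi_{k,\mathbf{s}})[0])},\ \dots,\ \frac{\Lambda(\varkappa_j(\phi_{k,\mathbf{s}})[k])}{\Lambda(\varkappa_j(\phi_{k,\mathbf{s}})[0])}\Big\},$$ an ordered list indexed by $l=0,\dots,k$; this definition presupposes $\Lambda(\varkappa_j(\phi_{k,\mathbf{s}})[0])\neq 0$. *)

theory Defs
  imports Complex_Main "Jordan_Normal_Form.Determinant"
begin

definition delay_vec :: "nat \<Rightarrow> (nat \<Rightarrow> nat) \<Rightarrow> (nat \<Rightarrow> complex) \<Rightarrow> nat \<Rightarrow> complex vec" where
  "delay_vec k \<phi> s m = vec k (\<lambda>i. s (\<phi> i + m))"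

text \<open>The signed volume depends on the order of the vertices, so a simplex is represented by the
  list of its vertices. The first vertex of all simplexes considered here is the origin.\<close>

type_synonym simplex = "complex vec list"

definition origin_simplex :: "nat \<Rightarrow> complex vec list \<Rightarrow> simplex" where
  "origin_simplex k vs = 0\<^sub>v k # vs"

definition volume :: "nat \<Rightarrow> simplex \<Rightarrow> complex" where
  "volume k \<sigma> = det (mat_of_cols k (tl \<sigma>)) / fact k"

text \<open>The vertices of the \<open>j\<close>-th union polyhedron other than the origin.\<close>

definition union_vertices ::
    "nat \<Rightarrow> (nat \<Rightarrow> nat) \<Rightarrow> (nat \<Rightarrow> complex) \<Rightarrow> nat \<Rightarrow> complex vec list" where
  "union_vertices k \<phi> s j = map (\<lambda>m. delay_vec k \<phi> s (j + m)) [0..<Suc k]"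

text \<open>The function \<^const>\<open>subseqs\<close> selects by position and keeps the order of the list. Sublists of
  equal length are produced in lexicographic order of the selected positions; the
  lemma \<open>nth_combinatorial_simplexes\<close> below gives the resulting entries.\<close>

definition combinatorial_simplexes ::
    "nat \<Rightarrow> (nat \<Rightarrow> nat) \<Rightarrow> (nat \<Rightarrow> complex) \<Rightarrow> nat \<Rightarrow> simplex list" where
  "combinatorial_simplexes k \<phi> s j =
     map (origin_simplex k) (filter (\<lambda>vs. length vs = k) (subseqs (union_vertices k \<phi> s j)))"

definition volume_quotients ::
    "nat \<Rightarrow> (nat \<Rightarrow> nat) \<Rightarrow> (nat \<Rightarrow> complex) \<Rightarrow> nat \<Rightarrow> complex list" where
  "volume_quotients k \<phi> s j =
     map (\<lambda>\<sigma>. volume k \<sigma> / volume k (combinatorial_simplexes k \<phi> s j ! 0))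
       (combinatorial_simplexes k \<phi> s j)"

definition elem_sym :: "nat \<Rightarrow> (nat \<Rightarrow> complex) \<Rightarrow> nat \<Rightarrow> complex" where
  "elem_sym k r l = (\<Sum>I | I \<subseteq> {1..k} \<and> card I = l. \<Prod>i\<in>I. r i)"

lemma length_le_subseqs: "ys \<in> set (subseqs xs) \<Longrightarrow> length ys \<le> length xs"
  by (induction xs arbitrary: ys) (fastforce simp: Let_def)+

lemma filter_subseqs_full: "filter (\<lambda>ys. length ys = length xs) (subseqs xs) = [xs]"
proof (induction xs)
  case (Cons x xs)
  have "filter (\<lambda>ys. length ys = Suc (length xs)) (subseqs xs) = []"
    using length_le_subseqs[of _ xs] by (fastforce simp: filter_empty_conv)
  with Cons show ?case
    by (simp add: Let_def filter_map comp_def)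
qed simp

lemma filter_subseqs_drop_one:
  "length xs = Suc n \<Longrightarrow> filter (\<lambda>ys. length ys = n) (subseqs xs) =
     map (\<lambda>l. take (n - l) xs @ drop (Suc (n - l)) xs) [0..<Suc n]"
proof (induction xs arbitrary: n)
  case (Cons x xs)
  have full: "filter (\<lambda>ys. length ys = n) (subseqs xs) = [xs]"
    using filter_subseqs_full[of xs] Cons.prems by simp
  show ?case
  proof (cases n)
    case 0
    with Cons.prems show ?thesis by (simp add: Let_def)
  next
    case (Suc m)
    have "filter (\<lambda>ys. length ys = m) (subseqs xs) =
        map (\<lambda>l. take (m - l) xs @ drop (Suc (m - l)) xs) [0..<Suc m]"
      using Cons Suc by simp
    moreover have "map (\<lambda>l. take (n - l) (x # xs) @ drop (Suc (n - l)) (x # xs)) [0..<Suc m] =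
        map (\<lambda>l. x # take (m - l) xs @ drop (Suc (m - l)) xs) [0..<Suc m]"
      by (rule map_cong) (auto simp: Suc Suc_diff_le)
    ultimately show ?thesis
      using full Suc by (simp add: Let_def filter_map comp_def del: upt_Suc)
        (simp add: upt_Suc)
  qed
qed simp

lemma length_combinatorial_simplexes: "length (combinatorial_simplexes k \<phi> s j) = Suc k"
  unfolding combinatorial_simplexes_def
  by (subst filter_subseqs_drop_one) (simp_all add: union_vertices_def)

lemma nth_combinatorial_simplexes:
  assumes "l \<le> k"
  shows "combinatorial_simplexes k \<phi> s j ! l = origin_simplex k
    (map (\<lambda>m. delay_vec k \<phi> s (j + m)) (filter (\<lambda>m. m \<noteq> k - l) [0..<Suc k]))"
proof -
  have split: "[0..<Suc k] = [0..<k - l] @ (k - l) # [Suc (k - l)..<Suc k]"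
    by (metis diff_le_self le_imp_less_Suc upt_conv_Cons upt_add_eq_append less_imp_le_nat
        le_add_diff_inverse zero_le)
  have f: "filter (\<lambda>m. m \<noteq> k - l) [0..<Suc k] = [0..<k - l] @ [Suc (k - l)..<Suc k]"
    unfolding split by (auto simp: filter_id_conv)
  show ?thesis
    unfolding combinatorial_simplexes_def f
    using assms by (subst filter_subseqs_drop_one)
      (simp_all add: union_vertices_def take_map drop_map del: upt_Suc)
qed

end

theory Submission
  imports Defs
begin

text \<open>The polynomial \<open>\<Prod>n. (x - r n)\<close> gives a linear recurrence of order \<open>k\<close> for \<open>s\<close> whose coefficients
  are, up to sign, the elementary symmetric polynomials. The recurrence expresses the last vertex of
  the union polyhedron by the other \<open>k\<close> vertices. Hence, after its last column is moved into the
  gap left by the omitted vertex, the determinant of the \<open>l\<close>-th simplex is evaluated by Cramer's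
  rule, and the sign of the column cycle cancels the sign of the coefficient.\<close>

lemma prod_diff_eq_sum_elem_sym:
  "(\<Prod>i=1..k. x - r i) = (\<Sum>l\<le>k. (-1) ^ l * elem_sym k r l * x ^ (k - l))"
proof -
  \<comment> \<open>Putting \<open>- r i\<close> first makes the \<open>I\<close> of
    \<open>prod_add\<close> the set of factors that contribute a root; grouping by
    \<open>card I\<close> then gives Vieta's formulas.\<close>
  have "(\<Prod>i=1..k. x - r i) = (\<Prod>i\<in>{1..k}. - r i + x)"
    by simp
  also have "\<dots> = (\<Sum>I\<in>Pow {1..k}. (\<Prod>i\<in>I. - r i) * (\<Prod>i\<in>{1..k} - I. x))"
    by (rule prod_add) simp
  also have "\<dots> = (\<Sum>I\<in>Pow {1..k}. (-1) ^ card I * (\<Prod>i\<in>I. r i) * x ^ (k - card I))"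
    by (rule sum.cong) (auto simp: prod_uminus card_Diff_subset finite_subset)
  also have "\<dots> = (\<Sum>l\<le>k. \<Sum>I | I \<in> Pow {1..k} \<and> card I = l.
      (-1) ^ card I * (\<Prod>i\<in>I. r i) * x ^ (k - card I))"
    by (rule sum.group[symmetric]) (auto dest: card_mono[rotated])
  also have "\<dots> = (\<Sum>l\<le>k. (-1) ^ l * elem_sym k r l * x ^ (k - l))"
    unfolding elem_sym_def sum_distrib_left sum_distrib_right
    by (intro sum.cong) (auto simp: mult_ac)
  finally show ?thesis .
qed

lemma elem_sym_0: "elem_sym k r 0 = 1"
proof -
  have "{I. I \<subseteq> {1..k} \<and> card I = 0} = {{}}"
    using finite_subset by fastforce
  then show ?thesis
    by (simp add: elem_sym_def)
qed

text \<open>\<open>r n\<close> is a root of the product in Vieta's formulas, which is then solved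
  for its leading power.\<close>

lemma power_eq_sum_elem_sym:
  assumes "n \<in> {1..k}"
  shows "r n ^ k = (\<Sum>m<k. - ((-1) ^ (k - m) * elem_sym k r (k - m)) * r n ^ m)"
proof -
  have "0 = (\<Prod>i=1..k. r n - r i)"
    using assms by (auto intro: prod_zero[symmetric])
  also have "\<dots> = (\<Sum>m\<le>k. (-1) ^ m * elem_sym k r m * r n ^ (k - m))"
    by (rule prod_diff_eq_sum_elem_sym)
  \<comment> \<open>Reversing the summation makes \<open>m\<close> the exponent, so the leading
    power is the last summand.\<close>
  also have "\<dots> = (\<Sum>m\<le>k. (-1) ^ (k - m) * elem_sym k r (k - m) * r n ^ m)"
    by (subst sum.atLeastAtMost_rev[of _ 0, unfolded atLeast0AtMost]) simp
  also have "\<dots> = (\<Sum>m<k. (-1) ^ (k - m) * elem_sym k r (k - m) * r n ^ m) + r n ^ k"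
    by (simp add: lessThan_Suc_atMost[symmetric] elem_sym_0)
  finally show ?thesis
    by (simp add: sum_negf eq_neg_iff_add_eq_0 add.commute)
qed

text \<open>Each geometric sequence \<open>r n ^ l\<close> satisfies this recurrence with the same
  coefficients, and the recurrence is linear.\<close>

lemma exponential_sum_recurrence:
  assumes "\<And>l. s l = (\<Sum>n=1..k. a n * r n ^ l)"
  shows "s (q + k) = (\<Sum>m<k. - ((-1) ^ (k - m) * elem_sym k r (k - m)) * s (q + m))"
proof -
  define c where "c m = - ((-1) ^ (k - m) * elem_sym k r (k - m))" for m
  have "s (q + k) = (\<Sum>n=1..k. a n * r n ^ q * (\<Sum>m<k. c m * r n ^ m))"
    unfolding assms by (rule sum.cong) (simp_all add: power_add power_eq_sum_elem_sym c_def)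
  also have "\<dots> = (\<Sum>m<k. \<Sum>n=1..k. a n * r n ^ q * (c m * r n ^ m))"
    unfolding sum_distrib_left by (rule sum.swap)
  also have "\<dots> = (\<Sum>m<k. c m * s (q + m))"
    unfolding assms sum_distrib_left by (simp add: power_add mult_ac)
  finally show ?thesis
    unfolding c_def .
qed

lemma det_omit_column:
  fixes w :: "nat \<Rightarrow> complex vec"
  assumes "p < k"
    and w: "\<And>i. i < k \<Longrightarrow> w k $ i = (\<Sum>m<k. c m * w m $ i)"
  shows "det (mat_of_cols k (map w (filter (\<lambda>m. m \<noteq> p) [0..<Suc k]))) =
    (-1) ^ (k - Suc p) * c p * det (mat_of_cols k (map w [0..<k]))"
proof -
  let ?A = "mat_of_cols k (map w (filter (\<lambda>m. m \<noteq> p) [0..<Suc k]))"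
  let ?D = "mat_of_cols k (map w [0..<k])"
  let ?x = "vec k c"
  have "[0..<Suc k] = [0..<p] @ p # [Suc p..<Suc k]"
    using assms(1) by (metis le_add_diff_inverse less_imp_le_nat less_Suc_eq upt_add_eq_append
        upt_conv_Cons zero_le)
  then have f: "filter (\<lambda>m. m \<noteq> p) [0..<Suc k] = [0..<p] @ [Suc p..<Suc k]"
    by (auto simp: filter_id_conv)
  have A: "?A \<in> carrier_mat k k" and D: "?D \<in> carrier_mat k k"
    unfolding f using assms(1) by (auto intro!: carrier_matI simp del: upt_Suc)
  have Dx: "?D *\<^sub>v ?x = vec k (\<lambda>i. w k $ i)"
    using w by (intro eq_vecI)
      (auto simp: scalar_prod_def mat_of_cols_index lessThan_atLeast0 mult.commute
        intro!: sum.cong)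
  \<comment> \<open>The last column of \<open>?A\<close> is \<open>w k\<close>. Swapping a final
    block of width 1 carries it to position \<open>p\<close>, past \<open>k - Suc p\<close>
    columns.\<close>
  have "det ?A = (-1) ^ ((k - Suc p) * 1) * det (mat k k (\<lambda>(i, j). ?A $$
      (i, if j < p then j else if j < p + 1 then j + (k - Suc p) else j - 1)))"
    by (rule det_swap_final_cols[OF A]) (use assms(1) in simp)
  also have "mat k k (\<lambda>(i, j). ?A $$
      (i, if j < p then j else if j < p + 1 then j + (k - Suc p) else j - 1)) =
      replace_col ?D (?D *\<^sub>v ?x) p"
    unfolding f Dx using assms(1)
    by (intro eq_matI)
      (auto simp: replace_col_def mat_of_cols_index nth_append simp del: upt_Suc)
  also have "det \<dots> = c p * det ?D"
    using cramer_lemma_mat[OF D, of ?x p] assms(1) by simp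
  finally show ?thesis
    by simp
qed

theorem theorem2:
  fixes k j :: nat and r a s :: "nat \<Rightarrow> complex" and \<phi> :: "nat \<Rightarrow> nat"
  assumes "k \<ge> 1"
    and "\<And>n. n \<in> {1..k} \<Longrightarrow> r n \<noteq> 0"
    and "inj_on r {1..k}"
    and "\<And>n. n \<in> {1..k} \<Longrightarrow> a n \<noteq> 0"
    and "\<And>l. s l = (\<Sum>n=1..k. a n * r n ^ l)"
    and "strict_mono_on {..<k} \<phi>"
    and "volume k (combinatorial_simplexes k \<phi> s j ! 0) \<noteq> 0"
  shows "volume_quotients k \<phi> s j = map (elem_sym k r) [0..<Suc k]"
proof -
  define w where "w m = delay_vec k \<phi> s (j + m)" for m
  let ?D = "det (mat_of_cols k (map w [0..<k]))"
  have vol: "volume k (combinatorial_simplexes k \<phi> s j ! l) =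
      det (mat_of_cols k (map w (filter (\<lambda>m. m \<noteq> k - l) [0..<Suc k]))) / fact k" if "l \<le> k" for l
    using that by (simp add: nth_combinatorial_simplexes volume_def origin_simplex_def w_def[abs_def]
        del: upt_Suc)
  \<comment> \<open>Coordinate \<open>i\<close> of \<open>w m\<close> is
    \<open>s (\<phi> i + j + m)\<close>, so the recurrence started at \<open>\<phi> i + j\<close>
    has the same coefficients in every row.\<close>
  have w: "w k $ i = (\<Sum>m<k. - ((-1) ^ (k - m) * elem_sym k r (k - m)) * w m $ i)"
    if "i < k" for i
    using exponential_sum_recurrence[OF assms(5), of "\<phi> i + j"] that
    by (simp add: w_def delay_vec_def add.assoc)
  have "filter (\<lambda>m. m \<noteq> k) [0..<Suc k] = [0..<k]"
    by (simp add: filter_id_conv)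
  then have vol0: "volume k (combinatorial_simplexes k \<phi> s j ! 0) = ?D / fact k"
    using vol[of 0] by simp
  have "volume k (combinatorial_simplexes k \<phi> s j ! l) = elem_sym k r l * ?D / fact k"
    if "l \<le> k" for l
  \<comment> \<open>\<open>l = 0\<close> omits \<open>w k\<close> itself and is treated apart, since
    \<open>det_omit_column\<close> takes a gap \<open>p < k\<close>.\<close>
  proof (cases l)
    case 0
    then show ?thesis
      by (simp add: vol0 elem_sym_0)
  next
    case (Suc l')
    \<comment> \<open>For the gap \<open>p = k - l\<close> the cycle has sign
      \<open>(-1) ^ l'\<close> and the coefficient is
      \<open>- ((-1) ^ Suc l' * elem_sym k r l)\<close>, so the signs cancel.\<close>
    with that have "k - l < k" "k - Suc (k - l) = l'" "k - (k - l) = Suc l'"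
      by auto
    then show ?thesis
      using det_omit_column[OF _ w, of "k - l"] vol[OF that] Suc
      by (simp flip: power_mult_distrib mult.assoc)
  qed
  \<comment> \<open>The nonzero first volume gives \<open>?D \<noteq> 0\<close>, so the common
    factor \<open>?D / fact k\<close> cancels in every entry.\<close>
  then show ?thesis
    using assms(7) vol0
    by (intro nth_equalityI)
      (simp_all add: volume_quotients_def length_combinatorial_simplexes del: upt_Suc)
qed

end
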